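(* Let $w_1,w_2$ be real numbers and let $r,a,b$ be real or complex numbers with $r\neq 0$ and $a\neq b$. Let $D\subset\mathbb{C}$ be a domain and let $u=u(z)$ be a holomorphic function on $D$ that omits the values $a$ and $b$ and for which holomorphic branches of $\log(u(z)-a)$ and $\log(u(z)-b)$ on $D$ exist and are fixed; all powers of $u-a$ and $u-b$ are taken with respect to these fixed branches. Suppose that $u$ satisfies on $D$ the differential equation $$u'(z)=r\,(u(z)-a)^{w_1}(u(z)-b)^{w_2}.$$ Then for every integer $n=2,3,\ldots$ and every $z\in D$, the $n$th derivative of $u$ equals $$u^{(n)}(z)=r^{n}\sum_{k=0}^{n-1}G(n,k)\,(u(z)-a)^{nw_1-n+k+1}\,(u(z)-b)^{nw_2-k},$$ where $G(n,k)$ are the generalized Eulerian numbers with parameters $w_1,w_2$.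
   Context: Generalized Eulerian numbers: for real parameters $w_1,w_2$, the array $G(n,k)$ ($n\ge 0$ and $k$ integers) is defined by the recurrence $$G(n+1,k)=(nw_1-n+k+1)\,G(n,k)+(nw_2-k+1)\,G(n,k-1),\qquad n\ge 0,$$ with boundary conditions $G(0,0)=1$, $G(0,k)=0$ for $k\neq 0$, and, for $n\ge1$, $G(n,k)=0$ whenever $k<0$ or $k\ge n$. Convention on powers: for a real exponent $s$, $(u-a)^{s}$ means $e^{s\log(u-a)}$ and $(u-b)^{s}$ means $e^{s\log(u-b)}$, where $\log(u-a)$ and $\log(u-b)$ denote the fixed holomorphic branches on $D$ (i.e. holomorphic functions $\ell_a,\ell_b$ on $D$ with $e^{\ell_a}=u-a$, $e^{\ell_b}=u-b$); the same branches are used for all exponents. *)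

theory Defs
  imports "HOL-Complex_Analysis.Complex_Analysis"
begin

primrec gen_euler :: "real \<Rightarrow> real \<Rightarrow> nat \<Rightarrow> int \<Rightarrow> real" where
  "gen_euler w1 w2 0 k = (if k = 0 then 1 else 0)"
| "gen_euler w1 w2 (Suc n) k =
     (of_nat n * w1 - of_nat n + of_int k + 1) * gen_euler w1 w2 n k
   + (of_nat n * w2 - of_int k + 1) * gen_euler w1 w2 n (k - 1)"

(* The boundary values for n >= 1 are usually listed together with the recurrence,
   but they already follow from it and from the row n = 0. *)
lemma gen_euler_boundary:
  assumes "n \<ge> 1" and "k < 0 \<or> k \<ge> int n"
  shows "gen_euler w1 w2 n k = 0"
  using assms
proof (induction n arbitrary: k rule: nat_induct_at_least)
  case base
  then show ?case by auto
next
  case (Suc n)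
  show ?case
  proof (cases "k = int n + 1 \<or> k < 0 \<or> k > int n + 1")
    case True
    then have "gen_euler w1 w2 n k = 0" "gen_euler w1 w2 n (k - 1) = 0"
      using Suc by auto
    then show ?thesis by simp
  qed (use Suc.prems in auto)
qed

(* l z plays the role of log (f z) for a fixed branch, so this is (f z) powr s with
   respect to that branch; the library's powr would force the principal branch. *)
definition branch_powr :: "(complex \<Rightarrow> complex) \<Rightarrow> real \<Rightarrow> complex \<Rightarrow> complex" where
  "branch_powr l s z = exp (complex_of_real s * l z)"

end

theory Submission
  imports Defs
begin

text \<open>Differentiating one term \<open>(u - a)\<^sup>\<alpha> (u - b)\<^sup>\<beta>\<close> with \<open>\<alpha> = n w\<^sub>1 - n + k + 1\<close>,
  \<open>\<beta> = n w\<^sub>2 - k\<close> and substituting the differential equation gives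
  \<open>r\<close> times a combination of the terms with indices \<open>(n + 1, k)\<close> and \<open>(n + 1, k + 1)\<close>, with
  coefficients \<open>\<alpha>\<close> and \<open>\<beta>\<close>; collecting coefficients yields the recurrence of \<open>G\<close>.
  The induction starts at \<open>n = 1\<close>, where the formula is the differential equation itself;
  it fails at \<open>n = 0\<close>.\<close>

lemma branch_powr_add: "branch_powr l (s + t) z = branch_powr l s z * branch_powr l t z"
  by (simp add: branch_powr_def ring_distribs exp_add)

text \<open>Differentiating \<open>exp (l x) = u x - c\<close> gives
  \<open>exp (l z) * deriv l z = deriv u z\<close>. Since \<open>exp (l z)\<close> is the branch
  power with exponent 1, trading \<open>deriv l z\<close> for \<open>deriv u z\<close> costs one
  unit of the exponent.\<close>

lemma has_field_derivative_branch_powr: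
  assumes "open D" "z \<in> D" "l holomorphic_on D" "u holomorphic_on D"
    and exp_l: "\<And>x. x \<in> D \<Longrightarrow> exp (l x) = u x - c"
  shows "(branch_powr l s has_field_derivative
      of_real s * branch_powr l (s - 1) z * deriv u z) (at z)"
proof -
  have dl: "(l has_field_derivative deriv l z) (at z)"
    and du: "(u has_field_derivative deriv u z) (at z)"
    using assms by (auto intro: holomorphic_derivI)
  have "((\<lambda>x. exp (l x)) has_field_derivative deriv u z) (at z)"
  proof (rule has_field_derivative_transform_within_open)
    show "((\<lambda>x. u x - c) has_field_derivative deriv u z) (at z)"
      by (auto intro!: derivative_eq_intros du)
  qed (use assms in auto)
  moreover have "((\<lambda>x. exp (l x)) has_field_derivative exp (l z) * deriv l z) (at z)"
    by (auto intro!: derivative_eq_intros dl)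
  ultimately have dexp: "deriv u z = exp (l z) * deriv l z"
    by (rule DERIV_unique)
  have "branch_powr l s z = branch_powr l (s - 1) z * exp (l z)"
    using branch_powr_add[of l "s - 1" 1 z] by (simp add: branch_powr_def)
  moreover have "(branch_powr l s has_field_derivative
      branch_powr l s z * (of_real s * deriv l z)) (at z)"
    unfolding branch_powr_def by (auto intro!: derivative_eq_intros dl)
  ultimately show ?thesis
    by (simp add: dexp mult_ac)
qed

text \<open>The recurrence regrouped by source: entry \<open>k\<close> of row \<open>n\<close> feeds
  entries \<open>k\<close> and \<open>k + 1\<close> of the next row. For \<open>n = 0\<close> this
  fails, because the nonzero value G(0,0) sits at \<open>k = n\<close>.\<close>

lemma sum_gen_euler_Suc:
  fixes T :: "nat \<Rightarrow> complex"
  assumes "n \<ge> 1"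
  shows "(\<Sum>k<Suc n. of_real (gen_euler w1 w2 (Suc n) (int k)) * T k) =
    (\<Sum>k<n. of_real (gen_euler w1 w2 n (int k)) *
      (of_real (real n * w1 - real n + real k + 1) * T k
        + of_real (real n * w2 - real k) * T (Suc k)))"
proof -
  define G where "G = gen_euler w1 w2 n"
  have "G (int n) = 0" "G (- 1) = 0"
    unfolding G_def using assms by (auto intro: gen_euler_boundary)
  have "(\<Sum>k<Suc n. of_real (gen_euler w1 w2 (Suc n) (int k)) * T k) =
      (\<Sum>k<Suc n. of_real ((real n * w1 - real n + real k + 1) * G (int k)) * T k)
      + (\<Sum>k<Suc n. of_real ((real n * w2 - real k + 1) * G (int k - 1)) * T k)"
    by (simp only: gen_euler.simps G_def of_real_add distrib_right sum.distrib of_int_of_nat_eq)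
  also have "(\<Sum>k<Suc n. of_real ((real n * w1 - real n + real k + 1) * G (int k)) * T k) =
      (\<Sum>k<n. of_real ((real n * w1 - real n + real k + 1) * G (int k)) * T k)"
    using \<open>G (int n) = 0\<close> by simp
  \<comment> \<open>The term at \<open>k = 0\<close> carries G(n,-1) = 0; shifting the index by one
    turns the factor \<open>real n * w2 - real k + 1\<close> into
    \<open>real n * w2 - real k\<close>.\<close>
  also have "(\<Sum>k<Suc n. of_real ((real n * w2 - real k + 1) * G (int k - 1)) * T k) =
      (\<Sum>k<n. of_real ((real n * w2 - real k) * G (int k)) * T (Suc k))"
    using \<open>G (- 1) = 0\<close> by (subst sum.lessThan_Suc_shift) simp
  finally show ?thesis
    by (simp add: G_def sum.distrib[symmetric] algebra_simps)
qed

theorem theorem1: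
  fixes w1 w2 :: real and r a b :: complex and D :: "complex set"
    and u la lb :: "complex \<Rightarrow> complex" and n :: nat and z :: complex
  assumes "r \<noteq> 0" and "a \<noteq> b"
    and "open D" and "connected D" and "D \<noteq> {}"
    and "u holomorphic_on D"
    and "\<And>x. x \<in> D \<Longrightarrow> u x \<noteq> a" and "\<And>x. x \<in> D \<Longrightarrow> u x \<noteq> b"
    and "la holomorphic_on D" and "\<And>x. x \<in> D \<Longrightarrow> exp (la x) = u x - a"
    and "lb holomorphic_on D" and "\<And>x. x \<in> D \<Longrightarrow> exp (lb x) = u x - b"
    and "\<And>x. x \<in> D \<Longrightarrow> deriv u x = r * branch_powr la w1 x * branch_powr lb w2 x"
    and "n \<ge> 2" and "z \<in> D"
  shows "(deriv ^^ n) u z =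
    r ^ n * (\<Sum>k=0..n-1. complex_of_real (gen_euler w1 w2 n (int k))
      * branch_powr la (real n * w1 - real n + real k + 1) z
      * branch_powr lb (real n * w2 - real k) z)"
proof -
  note du = assms(13)
  define T where "T n k x = branch_powr la (real n * w1 - real n + real k + 1) x
    * branch_powr lb (real n * w2 - real k) x" for n k x
  define S where "S n x = r ^ n * (\<Sum>k<n. of_real (gen_euler w1 w2 n (int k)) * T n k x)" for n x
  have dT: "(T n k has_field_derivative
      r * (of_real (real n * w1 - real n + real k + 1) * T (Suc n) k x
        + of_real (real n * w2 - real k) * T (Suc n) (Suc k) x)) (at x)"
    if "x \<in> D" for n k x
  proof -
    define \<alpha> \<beta> where "\<alpha> = real n * w1 - real n + real k + 1" and "\<beta> = real n * w2 - real k"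
    \<comment> \<open>Passing from \<open>n\<close> to \<open>Suc n\<close> changes the exponents to
      \<open>\<alpha> + w1 - 1\<close> and \<open>\<beta> + w2\<close> at index \<open>k\<close>,
      and to \<open>\<alpha> + w1\<close> and \<open>\<beta> + w2 - 1\<close> at
      \<open>Suc k\<close>: the two terms of the product rule after substituting
      \<open>du\<close>.\<close>
    have Ta: "T (Suc n) k x = branch_powr la (\<alpha> - 1) x * branch_powr la w1 x
          * (branch_powr lb \<beta> x * branch_powr lb w2 x)"
      and Tb: "T (Suc n) (Suc k) x = branch_powr la \<alpha> x * branch_powr la w1 x
          * (branch_powr lb (\<beta> - 1) x * branch_powr lb w2 x)"
      unfolding T_def branch_powr_add[symmetric] by (simp_all add: \<alpha>_def \<beta>_def algebra_simps)
    have "((\<lambda>x. branch_powr la \<alpha> x * branch_powr lb \<beta> x) has_field_derivative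
        of_real \<alpha> * branch_powr la (\<alpha> - 1) x * deriv u x * branch_powr lb \<beta> x
        + of_real \<beta> * branch_powr lb (\<beta> - 1) x * deriv u x * branch_powr la \<alpha> x) (at x)"
      using assms that
      by (intro DERIV_mult has_field_derivative_branch_powr[where D = D]) auto
    moreover have "T n k = (\<lambda>x. branch_powr la \<alpha> x * branch_powr lb \<beta> x)"
      by (simp add: T_def \<alpha>_def \<beta>_def fun_eq_iff)
    ultimately show ?thesis
      unfolding \<alpha>_def[symmetric] \<beta>_def[symmetric] Ta Tb du[OF that]
      by (simp add: algebra_simps)
  qed
  have dS: "(S n has_field_derivative S (Suc n) x) (at x)" if "n \<ge> 1" "x \<in> D" for n x
  proof -
    have "(S n has_field_derivative r ^ n * (\<Sum>k<n. of_real (gen_euler w1 w2 n (int k)) *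
        (r * (of_real (real n * w1 - real n + real k + 1) * T (Suc n) k x
          + of_real (real n * w2 - real k) * T (Suc n) (Suc k) x)))) (at x)"
      unfolding S_def by (intro DERIV_cmult DERIV_sum dT that)
    also have "(\<Sum>k<n. of_real (gen_euler w1 w2 n (int k)) *
        (r * (of_real (real n * w1 - real n + real k + 1) * T (Suc n) k x
          + of_real (real n * w2 - real k) * T (Suc n) (Suc k) x))) =
        r * (\<Sum>k<Suc n. of_real (gen_euler w1 w2 (Suc n) (int k)) * T (Suc n) k x)"
      by (simp only: sum_gen_euler_Suc[OF \<open>n \<ge> 1\<close>] sum_distrib_left mult.left_commute[of r])
    finally show ?thesis
      by (simp only: S_def[abs_def] power_Suc mult_ac)
  qed
  have "(deriv ^^ n) u x = S n x" if "n \<ge> 1" "x \<in> D" for n x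
    using that
  proof (induction n arbitrary: x rule: nat_induct_at_least)
    case base
    \<comment> \<open>The only summand has G(1,0) = 1 and exponents \<open>w1\<close> and
      \<open>w2\<close>.\<close>
    then show ?case
      by (simp add: S_def T_def du)
  next
    case (Suc n)
    \<comment> \<open>Equality at \<open>x\<close> alone would not suffice: the induction
      hypothesis, kept general in the point, identifies the \<open>n\<close>th derivative with
      \<open>S n\<close> on all of the open set \<open>D\<close>, so their derivatives at
      \<open>x\<close> agree.\<close>
    have "((deriv ^^ n) u has_field_derivative S (Suc n) x) (at x)"
      by (rule has_field_derivative_transform_within_open[OF dS])
        (use Suc assms in auto)
    then show ?case
      by (simp add: DERIV_imp_deriv)
  qed
  moreover have "{0..n - 1} = {..<n}"
    using \<open>n \<ge> 2\<close> by auto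
  ultimately show ?thesis
    using \<open>n \<ge> 2\<close> \<open>z \<in> D\<close> by (simp add: S_def T_def mult.assoc)
qed

end
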